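(* Let $K$ be a field of characteristic zero and $r\ge 2$. Let $y=Q(\underline{x},y)=\sum_{\underline{i},j}a_{\underline{i},j}\,\underline{x}^{\underline{i}}y^j$ be a strongly reduced Henselian equation. Define $\underline{\iota}_0=(\iota_{0,1},\ldots,\iota_{0,r})$ by $$-\iota_{0,k}:=\min\left(\{0\}\cup\{ i_k : a_{\underline{i},j}\neq 0,\ \underline{i} = (i_1,\ldots,i_k,\ldots,i_r)\}\right),\qquad k=1,\ldots,r.$$ Then the coefficients $c_{\underline{n}}$ of the unique solution $y_0=\sum_{\underline{n}>_{\mathrm{grlex}}\underline{0}} c_{\underline{n}}\underline{x}^{\underline{n}}\in K((x_1^{\mathbb{Z}},\ldots,x_r^{\mathbb{Z}}))^{\mathrm{grlex}}$ are given by $$ c_{\underline{n}}=\sum_{m=1}^{\mu_{\underline{n}}}\frac{1}{m}\sum_{|\underline{M}|=m,\ \|\underline{M}\|=m-1,\ G(\underline{M})=\underline{n}}\frac{m!}{\underline{M}!}\,\underline{A}^{\underline{M}},$$ where $\mu_{\underline{n}}$ is the greatest integer $m$ such that there exists an $\underline{M}$ with $|\underline{M}|=m$, $\|\underline{M}\|=m-1$ and $G(\underline{M})=\underline{n}$ (if there is no such $\underline{M}$, the sum is empty and equals $0$). Moreover, for $\underline{n}=(n_1,\ldots,n_r)$ (such that some such $\underline{M}$ exists), $\mu_{\underline{n}}\leq \sum_{k=1}^r\lambda_k\, n_k$ with $$\lambda_k=\begin{cases} \displaystyle\prod_{j=k+1}^{r-1}(1+\iota_{0,j})+\prod_{j=1}^{r-1}(1+\iota_{0,j})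 & \text{ if } k<r-1, \\ \displaystyle 1+\prod_{j=1}^{r-1}(1+\iota_{0,j})& \text{ if } k=r-1,\\ \displaystyle\prod_{j=1}^{r-1}(1+\iota_{0,j})& \text{ if } k=r.\end{cases}$$
   Context: For $\underline{n}\in\mathbb{Z}^r$ put $|\underline{n}|=n_1+\cdots+n_r$. Graded lexicographic order on $\mathbb{Z}^r$: $\underline{n}\leq_{\mathrm{grlex}}\underline{m}$ iff $|\underline{n}|<|\underline{m}|$, or $|\underline{n}|=|\underline{m}|$ and $\underline{n}\leq_{\mathrm{lex}}\underline{m}$ (lexicographic order comparing first coordinates first). $K((x_1^{\mathbb{Z}},\ldots,x_r^{\mathbb{Z}}))^{\mathrm{grlex}}$ is the field of generalized series $\sum_{\underline{n}\in\mathbb{Z}^r}c_{\underline{n}}\underline{x}^{\underline{n}}$ with coefficients in $K$ whose support is well-ordered for $\leq_{\mathrm{grlex}}$; its valuation $w$ sends a nonzero series to the $\leq_{\mathrm{grlex}}$-minimum of its support, and $w(0)=\infty$. For a polynomial $Q(\underline{x},y)=\sum_j a_j(\underline{x})y^j$ with coefficients in this field, $w(Q):=\min_j w(a_j)$. A strongly reduced Henselian equation is an equation $y=Q(\underline{x},y)$ with $Q\in K[x_1,x_1^{-1},\ldots,x_r,x_r^{-1}][y]$ such that $w(Q(\underline{x},y))>_{\mathrm{grlex}}\underline{0}$ and $Q(\underline{x},0)\not\equiv 0$. Such an equation has a unique solution of the form $y_0=\sum_{\underline{n}>_{\mathrm{grlex}}\underline{0}}c_{\underline{n}}\underline{x}^{\underline{n}}\in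 K((x_1^{\mathbb{Z}},\ldots,x_r^{\mathbb{Z}}))^{\mathrm{grlex}}$. Here $\underline{M}=(m_{\underline{i},j})_{\underline{i},j}$ ranges over vectors of nonnegative integers indexed by the (finitely many) pairs $(\underline{i},j)\in\mathbb{Z}^r\times\mathbb{N}$ with $a_{\underline{i},j}\neq0$, $\underline{A}=(a_{\underline{i},j})$, and $\underline{M}!:=\prod_{\underline{i},j}m_{\underline{i},j}!$, $\underline{A}^{\underline{M}}:=\prod_{\underline{i},j}a_{\underline{i},j}^{m_{\underline{i},j}}$, $|\underline{M}|:=\sum_{\underline{i},j}m_{\underline{i},j}$, $\|\underline{M}\|:=\sum_{\underline{i},j}m_{\underline{i},j}\,j$, $G(\underline{M}):=\sum_{\underline{i},j}m_{\underline{i},j}\,\underline{i}\in\mathbb{Z}^r$. Empty products equal $1$. *)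

theory Defs
  imports
    Complex_Main
    "HOL-Library.FuncSet"
    "HOL-Library.Extended"
    "HOL-Library.Poly_Mapping"
    "HOL-Computational_Algebra.Polynomial"
begin

section \<open>Exponents and the graded lexicographic order\<close>

text \<open>
  An exponent is a finitely supported integer vector; the exponents of \<open>\<int>\<^sup>r\<close> are those
  supported on the coordinates \<open>1, \<dots>, r\<close> (see \<open>Zr\<close> below).  The wrapper type only serves to
  replace the order of \<^typ>\<open>nat \<Rightarrow>\<^sub>0 int\<close>, which is lexicographic with lower coordinates
  compared first, by its graded version.
\<close>

datatype expo = Expo (coords: "nat \<Rightarrow>\<^sub>0 int")

definition coord :: "expo \<Rightarrow> nat \<Rightarrow> int" where
  "coord n k = Poly_Mapping.lookup (coords n) k"

definition total :: "expo \<Rightarrow> int" where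
  "total n = (\<Sum>k\<in>Poly_Mapping.keys (coords n). coord n k)"

instantiation expo :: ab_group_add
begin

definition "0 = Expo 0"
definition "n + m = Expo (coords n + coords m)"
definition "- n = Expo (- coords n)"
definition "n - m = Expo (coords n - coords m)"

instance
  by standard
    (auto simp: zero_expo_def plus_expo_def uminus_expo_def minus_expo_def expo.expand algebra_simps)

end

lemma total_eq_sum:
  assumes "finite A" "Poly_Mapping.keys (coords n) \<subseteq> A"
  shows "total n = (\<Sum>k\<in>A. coord n k)"
  unfolding total_def coord_def
  by (rule sum.mono_neutral_left) (use assms in \<open>auto simp: in_keys_iff\<close>)

lemma coord_add [simp]: "coord (n + m) k = coord n k + coord m k"
  by (simp add: coord_def plus_expo_def lookup_add)

lemma total_add [simp]: "total (n + m) = total n + total m"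
proof -
  let ?A = "Poly_Mapping.keys (coords n) \<union> Poly_Mapping.keys (coords m)"
  have "Poly_Mapping.keys (coords (n + m)) \<subseteq> ?A"
    by (simp add: plus_expo_def Poly_Mapping.keys_add)
  then have "total (n + m) = (\<Sum>k\<in>?A. coord (n + m) k)"
    by (intro total_eq_sum) auto
  also have "\<dots> = (\<Sum>k\<in>?A. coord n k) + (\<Sum>k\<in>?A. coord m k)"
    by (simp add: sum.distrib)
  also have "\<dots> = total n + total m"
    by (simp add: total_eq_sum [symmetric])
  finally show ?thesis .
qed

instantiation expo :: linordered_ab_group_add
begin

definition less_eq_expo :: "expo \<Rightarrow> expo \<Rightarrow> bool" where
  "n \<le> m \<longleftrightarrow> total n < total m \<or> total n = total m \<and> coords n \<le> coords m"

definition less_expo :: "expo \<Rightarrow> expo \<Rightarrow> bool" where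
  "n < m \<longleftrightarrow> total n < total m \<or> total n = total m \<and> coords n < coords m"

instance
proof
  fix a b c :: expo
  show "a + b \<le> a + c" if "b \<le> c"
    using that by (auto simp: less_eq_expo_def) (simp add: plus_expo_def add_left_mono)
qed (auto simp: less_eq_expo_def less_expo_def expo.expand)

end

definition scale :: "nat \<Rightarrow> expo \<Rightarrow> expo" where
  "scale c n = Expo (frag_cmul (int c) (coords n))"

definition Zr :: "nat \<Rightarrow> expo set" where
  "Zr r = {n. Poly_Mapping.keys (coords n) \<subseteq> {1..r}}"

section \<open>Well-ordered subsets of a linearly ordered abelian group\<close>

definition well_ordered :: "'a::linorder set \<Rightarrow> bool" where
  "well_ordered A \<longleftrightarrow> (\<forall>T\<subseteq>A. T \<noteq> {} \<longrightarrow> (\<exists>m\<in>T. \<forall>t\<in>T. m \<le> t))"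

lemma well_ordered_subset: "well_ordered B \<Longrightarrow> A \<subseteq> B \<Longrightarrow> well_ordered A"
  unfolding well_ordered_def by blast

lemma well_ordered_finite:
  assumes "finite A"
  shows "well_ordered A"
  unfolding well_ordered_def
proof (intro allI impI)
  fix T assume T: "T \<subseteq> A" "T \<noteq> {}"
  with assms have "finite T" by (auto intro: finite_subset)
  with T show "\<exists>m\<in>T. \<forall>t\<in>T. m \<le> t"
    by (intro bexI[of _ "Min T"]) auto
qed

lemma well_ordered_Un:
  assumes A: "well_ordered A" and B: "well_ordered B"
  shows "well_ordered (A \<union> B)"
  unfolding well_ordered_def
proof (intro allI impI)
  fix T assume T: "T \<subseteq> A \<union> B" "T \<noteq> {}"
  show "\<exists>m\<in>T. \<forall>t\<in>T. m \<le> t"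
  proof (cases "T \<inter> A = {} \<or> T \<inter> B = {}")
    case True
    then have "T \<subseteq> A \<or> T \<subseteq> B" using T by blast
    then show ?thesis using A B T(2) unfolding well_ordered_def by blast
  next
    case False
    obtain a where a: "a \<in> T \<inter> A" "\<forall>t\<in>T \<inter> A. a \<le> t"
      using A False unfolding well_ordered_def by (meson inf_le2)
    obtain b where b: "b \<in> T \<inter> B" "\<forall>t\<in>T \<inter> B. b \<le> t"
      using B False unfolding well_ordered_def by (meson inf_le2)
    have "min a b \<in> T" using a b by (simp add: min_def)
    moreover have "\<forall>t\<in>T. min a b \<le> t"
      using a(2) b(2) T(1) by (force simp: min_le_iff_disj)
    ultimately show ?thesis by blast
  qed
qed

lemma well_ordered_no_descent:
  assumes "well_ordered A" "\<And>n. s n \<in> A" "\<And>n. s (Suc n) < s n"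
  shows False
proof -
  have "\<exists>m\<in>range s. \<forall>t\<in>range s. m \<le> t"
    using assms(1,2) unfolding well_ordered_def by (metis image_is_empty image_subsetI empty_not_UNIV)
  then obtain N where "\<And>n. s N \<le> s n" by auto
  with assms(3)[of N] show False by (meson leD)
qed

lemma well_ordered_incseq:
  fixes s :: "nat \<Rightarrow> 'a::linorder"
  assumes "well_ordered A" "\<And>n. s n \<in> A"
  shows "\<exists>f::nat \<Rightarrow> nat. strict_mono f \<and> incseq (s \<circ> f)"
proof -
  obtain f :: "nat \<Rightarrow> nat" where f: "strict_mono f" "monoseq (\<lambda>n. s (f n))"
    using seq_monosub by blast
  show ?thesis
  proof (cases "incseq (\<lambda>n. s (f n))")
    case True
    with f show ?thesis by (auto simp: comp_def)
  next
    case False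
    with f(2) have dec: "decseq (\<lambda>n. s (f n))" by (simp add: monoseq_iff)
    have "\<exists>m\<in>range (s \<circ> f). \<forall>t\<in>range (s \<circ> f). m \<le> t"
      using assms unfolding well_ordered_def by (metis comp_apply image_is_empty image_subsetI empty_not_UNIV)
    then obtain N where N: "\<And>n. s (f N) \<le> s (f n)" by auto
    have "s (f (N + n)) = s (f N)" for n
      using decseqD[OF dec, of N "N + n"] N[of "N + n"] by simp
    then have "incseq (s \<circ> (\<lambda>n. f (N + n)))" by (simp add: incseq_def)
    moreover have "strict_mono (\<lambda>n. f (N + n))"
      using f(1) by (simp add: strict_mono_def)
    ultimately show ?thesis by blast
  qed
qed

lemma well_ordered_sums:
  fixes A B :: "'g::linordered_ab_group_add set"
  assumes A: "well_ordered A" and B: "well_ordered B"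
  shows "well_ordered {a + b |a b. a \<in> A \<and> b \<in> B}"
proof (rule ccontr)
  assume "\<not> ?thesis"
  then obtain T where T: "T \<subseteq> {a + b |a b. a \<in> A \<and> b \<in> B}" "T \<noteq> {}"
    and nomin: "\<And>m. m \<in> T \<Longrightarrow> \<exists>t\<in>T. t < m"
    unfolding well_ordered_def by (meson not_le)
  obtain s where s: "\<And>n. s n \<in> T" "\<And>n. s (Suc n) < s n"
    using dependent_nat_choice[of "\<lambda>_ x. x \<in> T" "\<lambda>_ x y. y < x"] T(2) nomin
    by (metis ex_in_conv)
  have "\<forall>n. \<exists>a b. a \<in> A \<and> b \<in> B \<and> s n = a + b" using s(1) T(1) by blast
  then obtain a b where ab: "\<And>n. a n \<in> A" "\<And>n. b n \<in> B" "\<And>n. s n = a n + b n" by metis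
  obtain f :: "nat \<Rightarrow> nat" where f: "strict_mono f" "incseq (a \<circ> f)"
    using well_ordered_incseq[OF A, of a] ab(1) by blast
  have "b (f (Suc n)) < b (f n)" for n
  proof -
    have "f n < f (Suc n)" using f(1) by (simp add: strict_mono_Suc_iff)
    then have "s (f (Suc n)) < s (f n)"
      by (rule lift_Suc_mono_less[of "\<lambda>n. - s n", simplified, OF s(2)])
    moreover have "a (f n) \<le> a (f (Suc n))" using incseq_SucD[OF f(2)] by simp
    ultimately show ?thesis
      using ab(3) by (metis add_le_less_mono add_mono not_le)
  qed
  then show False using well_ordered_no_descent[OF B, of "b \<circ> f"] ab(2) by simp
qed

definition decomps :: "'g::linordered_ab_group_add set \<Rightarrow> 'g set \<Rightarrow> 'g \<Rightarrow> ('g \<times> 'g) set" where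
  "decomps A B n = {(a, b). a \<in> A \<and> b \<in> B \<and> a + b = n}"

lemma finite_decomps:
  assumes A: "well_ordered A" and B: "well_ordered B"
  shows "finite (decomps A B n)"
proof (rule ccontr)
  assume "infinite (decomps A B n)"
  moreover have inj: "inj_on fst (decomps A B n)"
    by (auto simp: inj_on_def decomps_def)
  ultimately have "infinite (fst ` decomps A B n)" by (simp add: finite_image_iff)
  then obtain s :: "nat \<Rightarrow> 'a" where s: "inj s" "range s \<subseteq> fst ` decomps A B n"
    using infinite_countable_subset by blast
  have sA: "s k \<in> A" and sB: "n - s k \<in> B" for k
  proof -
    have "s k \<in> fst ` decomps A B n" using s(2) by blast
    then show "s k \<in> A" "n - s k \<in> B" by (auto simp: decomps_def)
  qed
  obtain f :: "nat \<Rightarrow> nat" where f: "strict_mono f" "incseq (s \<circ> f)"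
    using well_ordered_incseq[OF A, of s] sA by blast
  have "n - s (f (Suc k)) < n - s (f k)" for k
  proof -
    have "f k \<noteq> f (Suc k)" using f(1) by (metis n_not_Suc_n strict_mono_eq)
    then have "s (f k) \<noteq> s (f (Suc k))" using s(1) by (simp add: inj_eq)
    moreover have "s (f k) \<le> s (f (Suc k))" using incseq_SucD[OF f(2)] by simp
    ultimately show ?thesis by simp
  qed
  then show False using well_ordered_no_descent[OF B, of "\<lambda>k. n - s (f k)"] sB by simp
qed

section \<open>Generalized series\<close>

typedef (overloaded) ('g, 'k) gseries =
  "{f :: 'g::linordered_ab_group_add \<Rightarrow> 'k::zero. well_ordered {n. f n \<noteq> 0}}"
  morphisms gcoeff Abs_gseries
  by (rule exI[of _ "\<lambda>_. 0"]) (simp add: well_ordered_finite)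

definition gsupp :: "('g::linordered_ab_group_add, 'k::zero) gseries \<Rightarrow> 'g set" where
  "gsupp f = {n. gcoeff f n \<noteq> 0}"

lemma in_gsupp: "n \<in> gsupp f \<longleftrightarrow> gcoeff f n \<noteq> 0"
  by (simp add: gsupp_def)

lemma well_ordered_gsupp: "well_ordered (gsupp f)"
  using gcoeff[of f] by (simp add: gsupp_def)

lemma gseries_eqI: "(\<And>n. gcoeff f n = gcoeff g n) \<Longrightarrow> f = g"
  by (simp add: gcoeff_inject[symmetric] fun_eq_iff)

lemma gcoeff_Abs:
  assumes "well_ordered A" "{n. f n \<noteq> 0} \<subseteq> A"
  shows "gcoeff (Abs_gseries f) = f"
  by (rule Abs_gseries_inverse) (use assms well_ordered_subset in auto)

instantiation gseries :: (linordered_ab_group_add, comm_ring_1) comm_ring_1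
begin

definition "0 = Abs_gseries (\<lambda>_. 0)"
definition "1 = Abs_gseries (\<lambda>n. if n = 0 then 1 else 0)"
definition "f + g = Abs_gseries (\<lambda>n. gcoeff f n + gcoeff g n)"
definition "- f = Abs_gseries (\<lambda>n. - gcoeff f n)"
definition "f - g = Abs_gseries (\<lambda>n. gcoeff f n - gcoeff g n)"

text \<open>The convolution sums are finite by \<open>finite_decomps\<close>.\<close>
definition "f * g =
  Abs_gseries (\<lambda>n. \<Sum>(a, b)\<in>decomps (gsupp f) (gsupp g) n. gcoeff f a * gcoeff g b)"

lemma gcoeff_0 [simp]: "gcoeff (0 :: ('a, 'b) gseries) n = 0"
  unfolding zero_gseries_def by (subst gcoeff_Abs[of "{}"]) (auto simp: well_ordered_finite)

lemma gcoeff_1: "gcoeff (1 :: ('a, 'b) gseries) n = (if n = 0 then 1 else 0)"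
  unfolding one_gseries_def by (subst gcoeff_Abs[of "{0}"]) (auto simp: well_ordered_finite)

lemma gcoeff_add [simp]: "gcoeff (f + g :: ('a, 'b) gseries) n = gcoeff f n + gcoeff g n"
  unfolding plus_gseries_def
  by (subst gcoeff_Abs[of "gsupp f \<union> gsupp g"])
    (auto simp: well_ordered_Un well_ordered_gsupp in_gsupp)

lemma gcoeff_uminus [simp]: "gcoeff (- f :: ('a, 'b) gseries) n = - gcoeff f n"
  unfolding uminus_gseries_def
  by (subst gcoeff_Abs[of "gsupp f"]) (auto simp: well_ordered_gsupp in_gsupp)

lemma gcoeff_diff [simp]: "gcoeff (f - g :: ('a, 'b) gseries) n = gcoeff f n - gcoeff g n"
  unfolding minus_gseries_def
  by (subst gcoeff_Abs[of "gsupp f \<union> gsupp g"])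
    (auto simp: well_ordered_Un well_ordered_gsupp in_gsupp)

lemma gsupp_mult_aux:
  fixes f g :: "('a, 'b) gseries"
  shows "{n. (\<Sum>(a, b)\<in>decomps (gsupp f) (gsupp g) n. gcoeff f a * gcoeff g b) \<noteq> 0}
    \<subseteq> {a + b |a b. a \<in> gsupp f \<and> b \<in> gsupp g}"
proof
  fix n assume "n \<in> {n. (\<Sum>(a, b)\<in>decomps (gsupp f) (gsupp g) n. gcoeff f a * gcoeff g b) \<noteq> 0}"
  then have "decomps (gsupp f) (gsupp g) n \<noteq> {}" by auto
  then show "n \<in> {a + b |a b. a \<in> gsupp f \<and> b \<in> gsupp g}" by (auto simp: decomps_def)
qed

lemma gcoeff_mult:
  "gcoeff (f * g :: ('a, 'b) gseries) n
    = (\<Sum>(a, b)\<in>decomps (gsupp f) (gsupp g) n. gcoeff f a * gcoeff g b)"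
  unfolding times_gseries_def
  by (subst gcoeff_Abs[OF well_ordered_sums[OF well_ordered_gsupp well_ordered_gsupp] gsupp_mult_aux])
    simp

lemma gcoeff_mult_superset:
  fixes f g :: "('a, 'b) gseries"
  assumes A: "well_ordered A" "gsupp f \<subseteq> A" and B: "well_ordered B" "gsupp g \<subseteq> B"
  shows "gcoeff (f * g) n = (\<Sum>(a, b)\<in>decomps A B n. gcoeff f a * gcoeff g b)"
  unfolding gcoeff_mult
proof (rule sum.mono_neutral_left)
  show "finite (decomps A B n)" using A(1) B(1) by (rule finite_decomps)
  show "decomps (gsupp f) (gsupp g) n \<subseteq> decomps A B n"
    using A(2) B(2) by (auto simp: decomps_def)
  show "\<forall>p\<in>decomps A B n - decomps (gsupp f) (gsupp g) n.
      (case p of (a, b) \<Rightarrow> gcoeff f a * gcoeff g b) = 0"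
    by (auto simp: decomps_def gsupp_def)
qed

lemma gsupp_mult:
  "gsupp (f * g :: ('a, 'b) gseries) \<subseteq> {a + b |a b. a \<in> gsupp f \<and> b \<in> gsupp g}"
  using gsupp_mult_aux[of f g] by (simp add: gsupp_def[of "f * g"] gcoeff_mult)

instance
proof
  fix f g h :: "('a, 'b) gseries"
  show "f + g + h = f + (g + h)" "f + g = g + f" "0 + f = f" "- f + f = 0" "f - g = f + - g"
    by (rule gseries_eqI; simp add: algebra_simps)+
  show "f * g = g * f"
  proof (rule gseries_eqI)
    fix n
    show "gcoeff (f * g) n = gcoeff (g * f) n"
      unfolding gcoeff_mult
      by (rule sum.reindex_bij_witness[of _ prod.swap prod.swap])
        (auto simp: decomps_def algebra_simps)
  qed
  show "f * g * h = f * (g * h)"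
  proof (rule gseries_eqI)
    fix n
    let ?A = "gsupp f" and ?B = "gsupp g" and ?C = "gsupp h"
    let ?AB = "{a + b |a b. a \<in> ?A \<and> b \<in> ?B}" and ?BC = "{a + b |a b. a \<in> ?B \<and> b \<in> ?C}"
    note wo = well_ordered_gsupp well_ordered_sums
    have "gcoeff (f * g * h) n
        = (\<Sum>p\<in>decomps ?AB ?C n. \<Sum>q\<in>decomps ?A ?B (fst p).
            gcoeff f (fst q) * gcoeff g (snd q) * gcoeff h (snd p))"
      by (subst gcoeff_mult_superset[of ?AB _ ?C])
        (auto simp: wo gsupp_mult gcoeff_mult sum_distrib_right case_prod_unfold)
    also have "\<dots> = (\<Sum>(p, q)\<in>Sigma (decomps ?AB ?C n) (\<lambda>p. decomps ?A ?B (fst p)).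
            gcoeff f (fst q) * gcoeff g (snd q) * gcoeff h (snd p))"
      by (rule sum.Sigma) (auto intro!: finite_decomps simp: wo)
    also have "\<dots> = (\<Sum>(p, q)\<in>Sigma (decomps ?A ?BC n) (\<lambda>p. decomps ?B ?C (snd p)).
            gcoeff f (fst p) * (gcoeff g (fst q) * gcoeff h (snd q)))"
      by (rule sum.reindex_bij_witness[of _
            "\<lambda>(p, q). ((fst p + fst q, snd q), (fst p, fst q))"
            "\<lambda>(p, q). ((fst q, snd q + snd p), (snd q, snd p))"])
        (auto simp: decomps_def add.assoc mult.assoc, (metis add.assoc)+)
    also have "\<dots> = (\<Sum>p\<in>decomps ?A ?BC n. \<Sum>q\<in>decomps ?B ?C (snd p).
            gcoeff f (fst p) * (gcoeff g (fst q) * gcoeff h (snd q)))"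
      by (rule sum.Sigma[symmetric]) (auto intro!: finite_decomps simp: wo)
    also have "\<dots> = gcoeff (f * (g * h)) n"
      by (subst gcoeff_mult_superset[of ?A _ ?BC])
        (auto simp: wo gsupp_mult gcoeff_mult sum_distrib_left case_prod_unfold)
    finally show "gcoeff (f * g * h) n = gcoeff (f * (g * h)) n" .
  qed
  show "1 * f = f"
  proof (rule gseries_eqI)
    fix n
    have "gcoeff (1 * f) n = (\<Sum>(a, b)\<in>decomps {0} (gsupp f) n. gcoeff 1 a * gcoeff f b)"
      by (rule gcoeff_mult_superset)
        (auto simp: well_ordered_finite well_ordered_gsupp in_gsupp gcoeff_1 split: if_splits)
    also have "decomps {0} (gsupp f) n = (if n \<in> gsupp f then {(0, n)} else {})"
      by (auto simp: decomps_def)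
    finally show "gcoeff (1 * f) n = gcoeff f n"
      by (auto simp: gcoeff_1 in_gsupp)
  qed
  show "(f + g) * h = f * h + g * h"
  proof (rule gseries_eqI)
    fix n
    let ?A = "gsupp f \<union> gsupp g"
    have "well_ordered ?A" "gsupp (f + g) \<subseteq> ?A"
      by (auto simp: well_ordered_Un well_ordered_gsupp in_gsupp)
    then show "gcoeff ((f + g) * h) n = gcoeff (f * h + g * h) n"
      by (simp add: gcoeff_mult_superset[of ?A _ "gsupp h"] well_ordered_gsupp
          case_prod_unfold sum.distrib algebra_simps)
  qed
  have "gcoeff (0 :: ('a, 'b) gseries) 0 \<noteq> gcoeff 1 0"
    by (simp add: gcoeff_1)
  then show "(0 :: ('a, 'b) gseries) \<noteq> 1" by metis
qed

end

text \<open>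
  \<open>K((x\<^sub>1\<^sup>\<int>, \<dots>, x\<^sub>r\<^sup>\<int>))\<close> sits inside the series in countably many variables; on exponents in
  \<open>\<int>\<^sup>r\<close> the order of \<^typ>\<open>expo\<close> is the graded lexicographic one.
\<close>
definition series_field :: "nat \<Rightarrow> (expo, 'k::zero) gseries set" where
  "series_field r = {f. gsupp f \<subseteq> Zr r}"

definition val :: "('g::linordered_ab_group_add, 'k::comm_ring_1) gseries \<Rightarrow> 'g extended" where
  "val f = (if f = 0 then \<infinity> else Fin (LEAST n. n \<in> gsupp f))"

text \<open>Coefficients beyond the degree have valuation \<open>\<infinity>\<close> and do not affect the minimum.\<close>
definition val_poly ::
    "('g::linordered_ab_group_add, 'k::comm_ring_1) gseries poly \<Rightarrow> 'g extended" where
  "val_poly P = Min ((\<lambda>j. val (coeff P j)) ` {..degree P})"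

section \<open>Strongly reduced Henselian equations\<close>

text \<open>Laurent polynomials form the monoid algebra \<^typ>\<open>expo \<Rightarrow>\<^sub>0 'k\<close>.\<close>

definition laurent :: "nat \<Rightarrow> (expo \<Rightarrow>\<^sub>0 'k::zero) set" where
  "laurent r = {p. Poly_Mapping.keys p \<subseteq> Zr r}"

definition series_of :: "(expo \<Rightarrow>\<^sub>0 'k::zero) \<Rightarrow> (expo, 'k) gseries" where
  "series_of p = Abs_gseries (Poly_Mapping.lookup p)"

lemma gcoeff_series_of [simp]: "gcoeff (series_of p) n = Poly_Mapping.lookup p n"
  unfolding series_of_def
  by (subst gcoeff_Abs[of "Poly_Mapping.keys p"]) (auto simp: well_ordered_finite in_keys_iff)

definition series_poly :: "(expo \<Rightarrow>\<^sub>0 'k::comm_ring_1) poly \<Rightarrow> (expo, 'k) gseries poly" where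
  "series_poly Q = map_poly series_of Q"

lemma coeff_series_poly [simp]: "coeff (series_poly Q) j = series_of (coeff Q j)"
  unfolding series_poly_def
  by (rule coeff_map_poly) (simp add: gseries_eqI)

definition strongly_reduced :: "nat \<Rightarrow> (expo \<Rightarrow>\<^sub>0 'k::comm_ring_1) poly \<Rightarrow> bool" where
  "strongly_reduced r Q \<longleftrightarrow>
    (\<forall>j. coeff Q j \<in> laurent r) \<and> val_poly (series_poly Q) > 0 \<and> poly Q 0 \<noteq> 0"

definition is_solution ::
    "nat \<Rightarrow> (expo \<Rightarrow>\<^sub>0 'k::comm_ring_1) poly \<Rightarrow> (expo, 'k) gseries \<Rightarrow> bool" where
  "is_solution r Q y \<longleftrightarrow>
    y \<in> series_field r \<and> (\<forall>n\<in>gsupp y. n > 0) \<and> y = poly (series_poly Q) y"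

section \<open>Data of the coefficient formula\<close>

definition qcoeff :: "(expo \<Rightarrow>\<^sub>0 'k::zero) poly \<Rightarrow> expo \<times> nat \<Rightarrow> 'k" where
  "qcoeff Q = (\<lambda>(i, j). Poly_Mapping.lookup (coeff Q j) i)"

definition qsupp :: "(expo \<Rightarrow>\<^sub>0 'k::zero) poly \<Rightarrow> (expo \<times> nat) set" where
  "qsupp Q = {s. qcoeff Q s \<noteq> 0}"

lemma finite_qsupp: "finite (qsupp Q)"
proof (rule finite_subset)
  show "qsupp Q \<subseteq> (\<Union>j\<in>{..degree Q}. Poly_Mapping.keys (coeff Q j) \<times> {j})"
    by (force simp: qsupp_def qcoeff_def in_keys_iff intro: le_degree)
qed auto

text \<open>
  A vector \<open>M\<close> of multiplicities is a function on the finite set \<^term>\<open>qsupp Q\<close>.  In this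
  order, the next definitions are \<open>M!\<close>, \<open>A\<^sup>M\<close>, \<open>\<bar>M\<bar>\<close>, \<open>\<parallel>M\<parallel>\<close> and \<open>G(M)\<close>.
\<close>

definition vfact :: "(expo \<Rightarrow>\<^sub>0 'k::zero) poly \<Rightarrow> (expo \<times> nat \<Rightarrow> nat) \<Rightarrow> nat" where
  "vfact Q M = (\<Prod>s\<in>qsupp Q. fact (M s))"

definition vpower :: "(expo \<Rightarrow>\<^sub>0 'k::comm_ring_1) poly \<Rightarrow> (expo \<times> nat \<Rightarrow> nat) \<Rightarrow> 'k" where
  "vpower Q M = (\<Prod>s\<in>qsupp Q. qcoeff Q s ^ M s)"

definition vsize :: "(expo \<Rightarrow>\<^sub>0 'k::zero) poly \<Rightarrow> (expo \<times> nat \<Rightarrow> nat) \<Rightarrow> nat" where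
  "vsize Q M = (\<Sum>s\<in>qsupp Q. M s)"

definition vweight :: "(expo \<Rightarrow>\<^sub>0 'k::zero) poly \<Rightarrow> (expo \<times> nat \<Rightarrow> nat) \<Rightarrow> nat" where
  "vweight Q M = (\<Sum>(i, j)\<in>qsupp Q. M (i, j) * j)"

definition vexpo :: "(expo \<Rightarrow>\<^sub>0 'k::zero) poly \<Rightarrow> (expo \<times> nat \<Rightarrow> nat) \<Rightarrow> expo" where
  "vexpo Q M = (\<Sum>(i, j)\<in>qsupp Q. scale (M (i, j)) i)"

text \<open>
  The condition \<open>\<parallel>M\<parallel> = m - 1\<close> is read in the integers: with truncated subtraction the zero
  vector would wrongly be admitted for \<open>m = 0\<close>.
\<close>
definition index_vectors ::
    "(expo \<Rightarrow>\<^sub>0 'k::zero) poly \<Rightarrow> nat \<Rightarrow> expo \<Rightarrow> (expo \<times> nat \<Rightarrow> nat) set" where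
  "index_vectors Q m n =
    {M \<in> qsupp Q \<rightarrow>\<^sub>E UNIV. vsize Q M = m \<and> int (vweight Q M) = int m - 1 \<and> vexpo Q M = n}"

definition mu :: "(expo \<Rightarrow>\<^sub>0 'k::zero) poly \<Rightarrow> expo \<Rightarrow> nat" where
  "mu Q n = (if \<exists>m. index_vectors Q m n \<noteq> {} then GREATEST m. index_vectors Q m n \<noteq> {} else 0)"

definition iota0 :: "(expo \<Rightarrow>\<^sub>0 'k::zero) poly \<Rightarrow> nat \<Rightarrow> int" where
  "iota0 Q k = - Min ({0} \<union> {coord i k |i j. qcoeff Q (i, j) \<noteq> 0})"

definition lam :: "nat \<Rightarrow> (expo \<Rightarrow>\<^sub>0 'k::zero) poly \<Rightarrow> nat \<Rightarrow> int" where
  "lam r Q k =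
    (if k < r - 1 then (\<Prod>j=k+1..r-1. 1 + iota0 Q j) + (\<Prod>j=1..r-1. 1 + iota0 Q j)
     else if k = r - 1 then 1 + (\<Prod>j=1..r-1. 1 + iota0 Q j)
     else (\<Prod>j=1..r-1. 1 + iota0 Q j))"

end

theory Submission
  imports Defs
    "HOL-Computational_Algebra.Formal_Laurent_Series"
    "HOL-Computational_Algebra.Polynomial_FPS"
begin

text \<open>
  As \<open>y\<^sub>0\<close> is a root of \<open>y - Q(y)\<close>, division gives \<open>1 - Q(y) / y = (1 - y\<^sub>0 / y) (1 - D(y))\<close> with a
  polynomial \<open>D\<close> in \<open>y\<close>.  Take minus the logarithm and compare the coefficients of \<open>y\<^sup>-\<^sup>1\<close>: the
  first factor contributes \<open>y\<^sub>0\<close> and the second nothing, so \<open>y\<^sub>0\<close> is the sum of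
  \<open>1/m [y\<^bsup>m-1\<^esup>] Q(y)\<^sup>m\<close> over \<open>m\<close>, and the multinomial theorem expands the powers of \<open>Q\<close>.
  Convergence is measured by the linear form \<open>L(n) = \<Sum>k. \<lambda>\<^sub>k n\<^sub>k\<close>, which is at least \<open>1\<close> on every
  exponent of \<open>Q\<close>; hence only \<open>m \<le> L(n)\<close> contribute at \<open>n\<close>, which is also the bound on
  \<open>\<mu>\<^sub>n\<close>.  Logarithms are truncated, with an error controlled by \<open>L\<close>.
\<close>

section \<open>Filtered rings\<close>

text \<open>Membership in \<open>F k\<close> means order at least \<open>k\<close>, and congruence
  modulo \<open>F (Suc N)\<close> stands in for a limit. The notion serves twice: for generalized
  series and for Laurent series over them.\<close>

locale filtered_ring =
  fixes F :: "nat \<Rightarrow> 'a::comm_ring_1 set"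
  assumes zero_mem [simp, intro]: "0 \<in> F k"
    and one_mem [simp, intro]: "1 \<in> F 0"
    and add_mem [intro]: "a \<in> F k \<Longrightarrow> b \<in> F k \<Longrightarrow> a + b \<in> F k"
    and uminus_mem [intro]: "a \<in> F k \<Longrightarrow> - a \<in> F k"
    and mult_mem: "a \<in> F i \<Longrightarrow> b \<in> F j \<Longrightarrow> a * b \<in> F (i + j)"
    and Suc_mem: "a \<in> F (Suc k) \<Longrightarrow> a \<in> F k"
begin

lemma diff_mem [intro]: "a \<in> F k \<Longrightarrow> b \<in> F k \<Longrightarrow> a - b \<in> F k"
  using add_mem[of a k "- b"] uminus_mem[of b k] by simp

lemma antimono_mem: "i \<le> j \<Longrightarrow> a \<in> F j \<Longrightarrow> a \<in> F i"
  by (induction j rule: dec_induct) (auto dest: Suc_mem)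

lemma mult_mem_right: "a \<in> F 0 \<Longrightarrow> b \<in> F k \<Longrightarrow> a * b \<in> F k"
  using mult_mem[of a 0 b k] by simp

lemma sum_mem: "(\<And>x. x \<in> S \<Longrightarrow> f x \<in> F k) \<Longrightarrow> sum f S \<in> F k"
  by (induction S rule: infinite_finite_induct) auto

lemma poly_mem:
  assumes "\<And>j. coeff p j \<in> F k" "y \<in> F 0"
  shows "poly p y \<in> F k"
  using assms(1)
proof (induction p)
  case (pCons a p)
  have "a \<in> F k" using pCons.prems[of 0] by simp
  moreover have "poly p y \<in> F k" using pCons.IH pCons.prems[of "Suc _"] by simp
  ultimately show ?case using assms(2) by (auto intro: mult_mem_right)
qed simp

text \<open>By Horner's scheme the coefficients of the quotient are the values at \<open>y\<close>
  of the tails of \<open>p\<close>.\<close>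

lemma coeff_synthetic_div_mem:
  assumes "\<And>j. coeff p j \<in> F k" "y \<in> F 0"
  shows "coeff (synthetic_div p y) j \<in> F k"
  using assms(1)
proof (induction p arbitrary: j)
  case (pCons a p)
  have p: "coeff p i \<in> F k" for i using pCons.prems[of "Suc i"] by simp
  show ?case
    using pCons.IH[OF p] poly_mem[OF p assms(2)] by (cases j) simp_all
qed simp

text \<open>The Rees ring of the filtration: the polynomial variable records the order, and
  evaluation at 1 forgets it.\<close>

definition graded :: "'a poly set" where
  "graded = {p. \<forall>m. coeff p m \<in> F m}"

lemma graded_mult: "p \<in> graded \<Longrightarrow> q \<in> graded \<Longrightarrow> p * q \<in> graded"
  unfolding graded_def
proof safe
  fix m assume pq: "\<forall>m. coeff p m \<in> F m" "\<forall>m. coeff q m \<in> F m"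
  have "coeff p i * coeff q (m - i) \<in> F m" if "i \<le> m" for i
    using mult_mem[of "coeff p i" i "coeff q (m - i)" "m - i"] pq that by simp
  then show "coeff (p * q) m \<in> F m"
    unfolding coeff_mult by (intro sum_mem) simp
qed

lemma graded_power:
  assumes "p \<in> graded"
  shows "p ^ n \<in> graded"
proof (induction n)
  case 0
  show ?case by (auto simp: graded_def coeff_1)
next
  case (Suc n)
  then show ?case using assms by (simp add: graded_mult)
qed

text \<open>Each coefficient of a product is a finite sum of products of coefficients, so a
  coefficientwise filtration is again multiplicative. It makes the truncated logarithm available in
  the presence of negative powers.\<close>

lemma filtered_ring_fls: "filtered_ring (\<lambda>k. {f. \<forall>i. fls_nth f i \<in> F k})"
proof
  fix f g :: "'a fls" and i j
  assume "f \<in> {f. \<forall>k. fls_nth f k \<in> F i}" "g \<in> {f. \<forall>k. fls_nth f k \<in> F j}"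
  then show "f * g \<in> {f. \<forall>k. fls_nth f k \<in> F (i + j)}"
    by (auto simp: fls_times_nth(1) intro!: sum_mem mult_mem)
next
  show "1 \<in> {f :: 'a fls. \<forall>k. fls_nth f k \<in> F 0}"
    by (simp add: fls_one_nth)
next
  fix f :: "'a fls" and k
  assume "f \<in> {f. \<forall>i. fls_nth f i \<in> F (Suc k)}"
  then show "f \<in> {f. \<forall>i. fls_nth f i \<in> F k}"
    by (simp add: Suc_mem)
qed (simp_all add: add_mem uminus_mem)

end

section \<open>The truncated logarithm\<close>

text \<open>
  The sum below is \<open>log\<close> of \<open>(1 - a s) (1 - b s)\<close> minus the two separate logarithms, all
  truncated after the \<open>N\<close>-th term, up to sign.
\<close>
lemma truncated_log_mult_fps:
  fixes a b :: "'a::comm_ring_1" and inv :: "nat \<Rightarrow> 'a"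
  assumes inv: "\<And>m. m > 0 \<Longrightarrow> of_nat m * inv m = 1"
  defines "A \<equiv> fps_const a * fps_X" and "B \<equiv> fps_const b * fps_X"
  assumes n: "n \<le> N"
  shows "fps_nth (\<Sum>m=1..N. fps_const (inv m) * ((A + B - A * B) ^ m - A ^ m - B ^ m)) n = 0"
    (is "fps_nth ?P n = 0")
proof -
  define z where "z = A + B - A * B"
  define z' where "z' = fps_const a * (1 - B) + fps_const b * (1 - A)"
  have inv': "fps_const (inv m) * of_nat m = 1" if "m > 0" for m
    using inv[OF that] by (simp flip: fps_of_nat add: mult.commute)
  have dA: "fps_deriv A = fps_const a" and dB: "fps_deriv B = fps_const b"
    by (simp_all add: A_def B_def)
  have dz: "fps_deriv z = z'"
    by (simp add: z_def z'_def dA dB algebra_simps)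
  \<comment> \<open>Differentiation cancels the denominators and leaves geometric sums.\<close>
  have "fps_deriv (fps_const (inv m) * (z ^ m - A ^ m - B ^ m))
      = z ^ (m - 1) * z' - A ^ (m - 1) * fps_const a - B ^ (m - 1) * fps_const b"
    if "m \<in> {1..N}" for m
  proof -
    have "fps_deriv (fps_const (inv m) * (z ^ m - A ^ m - B ^ m))
        = (fps_const (inv m) * of_nat m) *
          (z ^ (m - 1) * z' - A ^ (m - 1) * fps_const a - B ^ (m - 1) * fps_const b)"
      by (simp add: fps_deriv_power' dz dA dB algebra_simps)
    then show ?thesis using inv' that by simp
  qed
  then have "fps_deriv ?P = (\<Sum>m=1..N.
      z ^ (m - 1) * z' - A ^ (m - 1) * fps_const a - B ^ (m - 1) * fps_const b)"
    by (simp add: fps_deriv_sum z_def)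
  also have "\<dots> = (\<Sum>m<N. z ^ m) * z' - (\<Sum>m<N. A ^ m) * fps_const a - (\<Sum>m<N. B ^ m) * fps_const b"
    unfolding sum_distrib_right sum_subtractf[symmetric]
    by (rule sum.reindex_bij_witness[of _ Suc "\<lambda>m. m - 1"]) auto
  finally have dP: "fps_deriv ?P =
      (\<Sum>m<N. z ^ m) * z' - (\<Sum>m<N. A ^ m) * fps_const a - (\<Sum>m<N. B ^ m) * fps_const b" .
  have zX: "z = fps_X * (fps_const a + fps_const b - A * fps_const b)"
    by (simp add: z_def A_def B_def algebra_simps)
  have power_N: "A ^ N = fps_X ^ N * fps_const (a ^ N)" "B ^ N = fps_X ^ N * fps_const (b ^ N)"
    "z ^ N = fps_X ^ N * (fps_const a + fps_const b - A * fps_const b) ^ N"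
    by (simp_all add: A_def B_def zX power_mult_distrib fps_const_power mult.commute)
  define W where "W = fps_const (a ^ N) * fps_const a * (1 - B)
      + fps_const (b ^ N) * fps_const b * (1 - A)
      - (fps_const a + fps_const b - A * fps_const b) ^ N * z'"
  \<comment> \<open>As \<open>1 - z = (1 - A) * (1 - B)\<close>, this factor collapses all three
    geometric sums. What survives carries \<open>A ^ N\<close>, \<open>B ^ N\<close> or
    \<open>z ^ N\<close>, hence \<open>fps_X ^ N\<close>.\<close>
  have "(1 - z) * fps_deriv ?P = ((1 - z) * (\<Sum>m<N. z ^ m)) * z'
      - (1 - B) * ((1 - A) * (\<Sum>m<N. A ^ m)) * fps_const a
      - (1 - A) * ((1 - B) * (\<Sum>m<N. B ^ m)) * fps_const b"
    unfolding dP by (simp add: z_def algebra_simps)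
  also have "\<dots> = (1 - z ^ N) * z' - (1 - B) * (1 - A ^ N) * fps_const a
      - (1 - A) * (1 - B ^ N) * fps_const b"
    by (simp add: one_diff_power_eq)
  also have "\<dots> = A ^ N * fps_const a * (1 - B) + B ^ N * fps_const b * (1 - A) - z ^ N * z'"
    by (simp add: z'_def algebra_simps)
  also have "\<dots> = fps_X ^ N * W"
    unfolding power_N W_def by (simp only: algebra_simps)
  finally have eq: "fps_deriv ?P = fps_X ^ N * W + z * fps_deriv ?P"
    by (simp add: algebra_simps)
  \<comment> \<open>Since \<open>fps_X\<close> divides \<open>z\<close>, each use of
    \<open>eq\<close> gains one more factor \<open>fps_X\<close>, up to exponent
    \<open>N\<close>.\<close>
  have "fps_X ^ k dvd fps_deriv ?P" if "k \<le> N" for k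
    using that
  proof (induction k)
    case (Suc k)
    have "fps_X * fps_X ^ k dvd z * fps_deriv ?P"
      using Suc by (intro mult_dvd_mono) (simp_all add: zX)
    moreover have "fps_X ^ Suc k dvd fps_X ^ N * W"
      using Suc.prems by (intro dvd_mult2 le_imp_power_dvd)
    ultimately show ?case
      by (subst eq) (simp add: dvd_add)
  qed simp
  then obtain V where V: "fps_deriv ?P = fps_X ^ N * V" by blast
  show ?thesis
  proof (cases n)
    case 0
    have "fps_nth (A ^ m) 0 = 0" "fps_nth (B ^ m) 0 = 0" "fps_nth (z ^ m) 0 = 0" if "m > 0" for m
      using that by (simp_all add: A_def B_def zX fps_power_zeroth zero_power)
    then show ?thesis using 0 by (simp add: fps_sum_nth z_def)
  next
    case (Suc l)
    \<comment> \<open>The derivative only shows that \<open>n\<close> times the coefficient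
      vanishes; the assumed inverse of \<open>n\<close> removes the factor.\<close>
    have "of_nat n * fps_nth ?P n = fps_nth (fps_deriv ?P) l"
      using Suc by simp
    also have "\<dots> = 0"
      unfolding V using n Suc by (simp add: fps_X_power_mult_nth)
    finally have eq0: "of_nat n * fps_nth ?P n = 0" .
    have "inv n * of_nat n = 1"
      using inv[of n] Suc by (simp only: mult.commute zero_less_Suc)
    then have "fps_nth ?P n = inv n * (of_nat n * fps_nth ?P n)"
      by (simp only: mult.assoc[symmetric] mult_1_left)
    then show ?thesis unfolding eq0 mult_zero_right .
  qed
qed

context filtered_ring
begin

text \<open>With \<open>[:0, a:]\<close> and \<open>[:0, b:]\<close> in place of \<open>a\<close>
  and \<open>b\<close> the sum lies in the Rees ring. The formal identity kills its coefficients up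
  to degree \<open>N\<close>, the others lie in \<open>F (Suc N)\<close>, and evaluation at 1
  returns the sum.\<close>

lemma truncated_log_mult:
  fixes inv :: "nat \<Rightarrow> 'a"
  assumes inv: "\<And>m. m > 0 \<Longrightarrow> of_nat m * inv m = 1" "\<And>m. inv m \<in> F 0"
    and a: "a \<in> F 1" and b: "b \<in> F 1"
  shows "(\<Sum>m=1..N. inv m * ((a + b - a * b) ^ m - a ^ m - b ^ m)) \<in> F (Suc N)"
proof -
  define p where "p = (\<Sum>m=1..N. [:inv m:] *
    (([:0, a:] + [:0, b:] - [:0, a:] * [:0, b:]) ^ m - [:0, a:] ^ m - [:0, b:] ^ m))"
  have linear: "[:0, c:] \<in> graded" if "c \<in> F 1" for c
    using that by (auto simp: graded_def coeff_pCons split: nat.split)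
  have const: "[:c:] \<in> graded" if "c \<in> F 0" for c
    using that by (auto simp: graded_def coeff_pCons split: nat.split)
  have graded_diff: "x - y \<in> graded" if "x \<in> graded" "y \<in> graded" for x y
    using that by (auto simp: graded_def)
  have graded_add: "x + y \<in> graded" if "x \<in> graded" "y \<in> graded" for x y
    using that by (auto simp: graded_def)
  have graded_sum: "sum f S \<in> graded" if "\<And>x. x \<in> S \<Longrightarrow> f x \<in> graded" for f and S :: "nat set"
    using that by (auto simp: graded_def coeff_sum intro: sum_mem)
  have p: "p \<in> graded"
    unfolding p_def
    by (intro graded_sum graded_mult graded_diff graded_power graded_add const linear inv a b)
  have coeff0: "coeff p n = 0" if "n \<le> N" for n
  proof -
    have lin: "fps_of_poly [:0, c:] = fps_const c * fps_X" for c :: 'a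
      by (simp add: fps_of_poly_pCons)
    have "fps_nth (fps_of_poly p) n = 0"
      unfolding p_def fps_of_poly_sum fps_of_poly_mult fps_of_poly_diff fps_of_poly_add
        fps_of_poly_power fps_of_poly_const lin
      by (rule truncated_log_mult_fps[OF inv(1) that])
    then show ?thesis by simp
  qed
  have "(\<Sum>m=1..N. inv m * ((a + b - a * b) ^ m - a ^ m - b ^ m)) = poly p 1"
    by (simp add: p_def poly_sum mult.commute)
  also have "\<dots> = (\<Sum>i\<le>degree p. coeff p i)"
    by (simp add: poly_altdef)
  also have "\<dots> \<in> F (Suc N)"
  proof (rule sum_mem)
    fix i
    show "coeff p i \<in> F (Suc N)"
    proof (cases "i \<le> N")
      case False
      then show ?thesis using p antimono_mem[of "Suc N" i] by (auto simp: graded_def)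
    qed (simp add: coeff0)
  qed
  finally show ?thesis .
qed

section \<open>Lagrange inversion\<close>

text \<open>The indeterminate of the overview is \<open>fls_X\<close> here, and \<open>y\<close> is
  the root.\<close>

theorem lagrange_inversion:
  fixes inv :: "nat \<Rightarrow> 'a" and q :: "'a poly"
  assumes inv: "\<And>m. m > 0 \<Longrightarrow> of_nat m * inv m = 1" "\<And>m. inv m \<in> F 0"
    and q: "\<And>j. coeff q j \<in> F 1" and y: "y \<in> F 1" "poly q y = y" and "N \<ge> 1"
  shows "(\<Sum>m=1..N. inv m * coeff (q ^ m) (m - 1)) - y \<in> F (Suc N)"
proof -
  interpret fls: filtered_ring "\<lambda>k. {f. \<forall>i. fls_nth f i \<in> F k}"
    by (rule filtered_ring_fls)
  define D where "D = synthetic_div q y"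
  define \<phi> :: "'a poly \<Rightarrow> 'a fls" where "\<phi> p = fps_to_fls (fps_of_poly p)" for p
  have \<phi>_power: "\<phi> (p ^ n) = \<phi> p ^ n" for p n
    by (simp add: \<phi>_def fps_of_poly_power fps_to_fls_power)
  have \<phi>_nth: "fls_nth (\<phi> p) (int n) = coeff p n" for p n
    by (simp add: \<phi>_def)
  have \<phi>_nth_neg: "fls_nth (\<phi> p) i = 0" if "i < 0" for p i
    using that by (simp add: \<phi>_def)
  \<comment> \<open>These are chosen so that \<open>(1 - a) * (1 - b)\<close> is
    \<open>1 - q / X\<close>; this is the fact \<open>ab\<close>.\<close>
  define a where "a = fls_X_inv * fls_const y"
  define b where "b = \<phi> D"
  have a_power: "a ^ m = fls_X_inv ^ m * fls_const (y ^ m)" for m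
    by (simp add: a_def power_mult_distrib fls_const_power)
  have "y \<in> F 0" using y(1) antimono_mem[of 0 1] by simp
  have a1: "fls_nth a i \<in> F 1" for i
    using y(1) by (simp add: a_def fls_X_inv_times_conv_shift)
  have b1: "fls_nth b i \<in> F 1" for i
    using coeff_synthetic_div_mem[OF q \<open>y \<in> F 0\<close>]
    by (cases "i < 0") (auto simp: b_def D_def \<phi>_def)
  \<comment> \<open>The remainder on division by \<open>X - y\<close> is \<open>poly q y\<close>,
    which equals \<open>y\<close>.\<close>
  have q_eq: "q = [:- y, 1:] * D + [:y:]"
    using synthetic_div_correct'[of y q] y(2) by (simp add: D_def)
  have \<phi>q: "\<phi> q = (fls_X - fls_const y) * b + fls_const y"
  proof -
    have "\<phi> q = \<phi> [:- y, 1:] * b + \<phi> [:y:]"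
      by (subst q_eq) (simp only: \<phi>_def b_def fps_of_poly_add fps_of_poly_mult
          fls_times_fps_to_fls fps_to_fls_plus)
    moreover have "\<phi> [:- y, 1:] = fls_X - fls_const y" "\<phi> [:y:] = fls_const y"
      by (simp_all add: \<phi>_def fps_of_poly_pCons fps_of_poly_const)
    ultimately show ?thesis by simp
  qed
  have ab: "a + b - a * b = fls_X_inv * \<phi> q"
  proof -
    have "fls_X_inv * \<phi> q = (fls_X_inv * fls_X) * b - a * b + a"
      by (simp add: \<phi>q a_def algebra_simps)
    moreover have "(fls_X_inv :: 'a fls) * fls_X = 1"
      by (intro fls_eqI) (simp add: fls_X_inv_times_conv_shift)
    ultimately show ?thesis by simp
  qed
  \<comment> \<open>At \<open>X\<close> to the power -1, \<open>a ^ m\<close> contributes only for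
    \<open>m = 1\<close>, powers of the polynomial \<open>b\<close> nothing, and
    \<open>(q / X) ^ m\<close> the coefficient of \<open>q ^ m\<close> in degree
    \<open>m - 1\<close>.\<close>
  have "fls_nth (\<Sum>m=1..N. fls_const (inv m) * ((a + b - a * b) ^ m - a ^ m - b ^ m)) (- 1) \<in> F (Suc N)"
    using fls.truncated_log_mult[of "\<lambda>m. fls_const (inv m)" a b N] inv a1 b1
    by (auto simp: fls_of_nat)
  also have "fls_nth (\<Sum>m=1..N. fls_const (inv m) * ((a + b - a * b) ^ m - a ^ m - b ^ m)) (- 1)
     = (\<Sum>m=1..N. inv m * coeff (q ^ m) (m - 1) - (if m = 1 then y else 0))"
    unfolding fls_nth_sum
  proof (rule sum.cong)
    fix m assume m: "m \<in> {1..N}"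
    have "fls_nth ((a + b - a * b) ^ m) (- 1) = coeff (q ^ m) (m - 1)"
    proof -
      have "(a + b - a * b) ^ m = fls_shift (int m) (\<phi> (q ^ m))"
        by (simp add: ab power_mult_distrib fls_X_inv_power_times_conv_shift \<phi>_power)
      then show ?thesis using m \<phi>_nth[of "q ^ m" "m - 1"] by (simp add: of_nat_diff)
    qed
    moreover have "fls_nth (b ^ m) (- 1) = 0"
      by (simp add: b_def \<phi>_nth_neg flip: \<phi>_power)
    moreover have "fls_nth (a ^ m) (- 1) = (if m = 1 then y else 0)"
      by (auto simp: a_power fls_X_inv_power_times_conv_shift)
    moreover have "inv 1 = 1" using inv(1)[of 1] by simp
    ultimately show "fls_nth (fls_const (inv m) * ((a + b - a * b) ^ m - a ^ m - b ^ m)) (- 1)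
        = inv m * coeff (q ^ m) (m - 1) - (if m = 1 then y else 0)"
      by (simp add: algebra_simps)
  qed simp
  also have "\<dots> = (\<Sum>m=1..N. inv m * coeff (q ^ m) (m - 1)) - y"
    using \<open>N \<ge> 1\<close> by (simp add: sum_subtractf)
  finally show ?thesis .
qed

end

section \<open>The multinomial theorem\<close>

text \<open>Extensional functions, as in \<open>index_vectors\<close>, so that each vector is
  counted once.\<close>

definition multiplicities :: "'b set \<Rightarrow> nat \<Rightarrow> ('b \<Rightarrow> nat) set" where
  "multiplicities S m = {M \<in> S \<rightarrow>\<^sub>E UNIV. sum M S = m}"

lemma finite_multiplicities:
  assumes "finite S"
  shows "finite (multiplicities S m)"
proof (rule finite_subset)
  show "multiplicities S m \<subseteq> S \<rightarrow>\<^sub>E {..m}"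
    using assms by (auto simp: multiplicities_def intro: member_le_sum)
qed (use assms in \<open>auto intro: finite_PiE\<close>)

text \<open>Multinomial coefficients are integers; this makes the \<open>div\<close> below
  exact.\<close>

lemma prod_fact_dvd_fact_sum: "(\<Prod>s\<in>S. fact (M s)) dvd (fact (sum M S) :: nat)"
proof (induction S rule: infinite_finite_induct)
  case (insert x S)
  then have "(\<Prod>s\<in>insert x S. fact (M s) :: nat) dvd fact (M x) * fact (sum M S)"
    by simp
  also have "\<dots> dvd fact (M x + sum M S)" by (rule fact_fact_dvd_fact)
  finally show ?case using insert by simp
qed auto

text \<open>To arrange a multiset, first choose the places of \<open>x\<close>, then arrange the
  rest.\<close>

lemma fact_div_prod_fact_insert:
  assumes "finite S" "x \<notin> S"
  shows "fact (sum M (insert x S)) div (\<Prod>s\<in>insert x S. fact (M s)) =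
    (sum M (insert x S) choose M x) * (fact (sum M S) div (\<Prod>s\<in>S. fact (M s)))"
proof -
  obtain d :: nat where d: "fact (sum M S) = (\<Prod>s\<in>S. fact (M s)) * d"
    using prod_fact_dvd_fact_sum[of M S] by blast
  have pos: "(\<Prod>s\<in>S. fact (M s)) > (0::nat)" by (simp add: prod_pos)
  have "fact (M x + sum M S) = (M x + sum M S choose M x) * fact (M x) * (fact (sum M S) :: nat)"
    using binomial_fact_lemma[of "M x" "M x + sum M S"] by (simp add: ac_simps)
  also have "\<dots> = (fact (M x) * (\<Prod>s\<in>S. fact (M s))) * ((M x + sum M S choose M x) * d)"
    by (simp add: d ac_simps)
  finally show ?thesis
    using assms pos by (simp add: d)
qed

text \<open>The binomial theorem splits off the power of one element \<open>x\<close>, and induction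
  treats the rest. The coefficient is an integer quotient because the theorem is applied in a
  polynomial ring, where division is not at hand.\<close>

theorem multinomial:
  fixes g :: "'b \<Rightarrow> 'a::comm_semiring_1"
  assumes "finite S"
  shows "(\<Sum>s\<in>S. g s) ^ m =
    (\<Sum>M\<in>multiplicities S m. of_nat (fact m div (\<Prod>s\<in>S. fact (M s))) * (\<Prod>s\<in>S. g s ^ M s))"
  using assms
proof (induction S arbitrary: m rule: finite_induct)
  case empty
  have "multiplicities ({} :: 'b set) m = (if m = 0 then {\<lambda>_. undefined} else {})"
    by (auto simp: multiplicities_def)
  then show ?case by (cases m) simp_all
next
  case (insert x S)
  \<comment> \<open>Written with \<open>sum M S\<close> instead of \<open>m\<close>, the coefficient
    depends on \<open>M\<close> alone while the exponent varies.\<close>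
  let ?c = "\<lambda>S M. fact (sum M S) div (\<Prod>s\<in>S. fact (M s)) :: nat"
  have IH: "(\<Sum>s\<in>S. g s) ^ m = (\<Sum>M\<in>multiplicities S m. of_nat (?c S M) * (\<Prod>s\<in>S. g s ^ M s))" for m
    unfolding insert.IH by (rule sum.cong) (auto simp: multiplicities_def)
  have "(\<Sum>s\<in>insert x S. g s) ^ m
      = (\<Sum>k\<le>m. of_nat (m choose k) * g x ^ k * (\<Sum>s\<in>S. g s) ^ (m - k))"
    using insert.hyps by (simp add: binomial_ring)
  also have "\<dots> = (\<Sum>k\<le>m. \<Sum>M\<in>multiplicities S (m - k).
      of_nat (m choose k) * g x ^ k * (of_nat (?c S M) * (\<Prod>s\<in>S. g s ^ M s)))"
    by (simp add: IH sum_distrib_left)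
  also have "\<dots> = (\<Sum>(k, M)\<in>Sigma {..m} (\<lambda>k. multiplicities S (m - k)).
      of_nat (m choose k) * g x ^ k * (of_nat (?c S M) * (\<Prod>s\<in>S. g s ^ M s)))"
    by (rule sum.Sigma) (auto simp: finite_multiplicities insert.hyps)
  also have "\<dots> = (\<Sum>M\<in>multiplicities (insert x S) m.
      of_nat (?c (insert x S) M) * (\<Prod>s\<in>insert x S. g s ^ M s))"
  \<comment> \<open>Removing \<open>x\<close> resets the value there to \<open>undefined\<close>, as
    extensionality on \<open>S\<close> demands.\<close>
  proof (rule sum.reindex_bij_witness[of _ "\<lambda>M. (M x, M(x := undefined))" "\<lambda>(k, M). M(x := k)"], goal_cases)
    case (1 p)
    then obtain k M where p: "p = (k, M)" "M \<in> S \<rightarrow>\<^sub>E UNIV"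
      by (auto simp: multiplicities_def)
    have "M x = undefined" by (rule PiE_arb[OF p(2) insert.hyps(2)])
    then show ?case by (simp add: p(1) fun_upd_idem)
  next
    case (2 p)
    then obtain k M where p: "p = (k, M)" "k \<le> m" "M \<in> S \<rightarrow>\<^sub>E UNIV" "sum M S = m - k"
      by (auto simp: multiplicities_def)
    have "sum (M(x := k)) S = sum M S"
      using insert.hyps by (intro sum.cong) auto
    moreover have "M(x := k) \<in> insert x S \<rightarrow>\<^sub>E UNIV"
      using p(3) by (intro PiE_fun_upd) auto
    ultimately show ?case using insert.hyps p by (simp add: multiplicities_def)
  next
    case (3 M)
    show ?case by simp
  next
    case (4 M)
    then have M: "M \<in> insert x S \<rightarrow>\<^sub>E UNIV" "sum M (insert x S) = m"
      by (auto simp: multiplicities_def)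
    have "sum (M(x := undefined)) S = sum M S"
      using insert.hyps by (intro sum.cong) auto
    moreover have "M(x := undefined) \<in> S \<rightarrow>\<^sub>E UNIV"
      by (rule fun_upd_in_PiE[OF insert.hyps(2) M(1)])
    moreover have "M x + sum M S = m" using M(2) insert.hyps by simp
    ultimately show ?case by (auto simp: multiplicities_def)
  next
    case (5 p)
    obtain k M where p: "p = (k, M)" "k \<le> m" "sum M S = m - k"
      using 5 by (auto simp: multiplicities_def)
    have sum_eq: "sum (M(x := k)) S = sum M S"
      and prod_eq: "(\<Prod>s\<in>S. fact ((M(x := k)) s)) = (\<Prod>s\<in>S. fact (M s) :: nat)"
      and g_eq: "(\<Prod>s\<in>S. g s ^ (M(x := k)) s) = (\<Prod>s\<in>S. g s ^ M s)"
      using insert.hyps by (auto intro: sum.cong prod.cong)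
    have "sum (M(x := k)) (insert x S) = m"
      using insert.hyps p sum_eq by simp
    then have "?c (insert x S) (M(x := k)) = (m choose k) * ?c S M"
      using fact_div_prod_fact_insert[OF insert.hyps, of "M(x := k)"] sum_eq prod_eq by simp
    moreover have "(\<Prod>s\<in>insert x S. g s ^ (M(x := k)) s) = g x ^ k * (\<Prod>s\<in>S. g s ^ M s)"
      using insert.hyps g_eq by simp
    ultimately show ?case unfolding p(1) by (simp add: algebra_simps)
  qed
  also have "\<dots> = (\<Sum>M\<in>multiplicities (insert x S) m.
      of_nat (fact m div (\<Prod>s\<in>insert x S. fact (M s))) * (\<Prod>s\<in>insert x S. g s ^ M s))"
    by (rule sum.cong) (auto simp: multiplicities_def)
  finally show ?case .
qed

section \<open>Monomials and filtrations of generalized series\<close>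

abbreviation gmonom :: "expo \<Rightarrow> 'k::comm_ring_1 \<Rightarrow> (expo, 'k) gseries" where
  "gmonom i a \<equiv> series_of (Poly_Mapping.single i a)"

lemma gsupp_gmonom: "gsupp (gmonom i a) \<subseteq> {i}"
  by (auto simp: in_gsupp lookup_single when_def split: if_splits)

lemma gmonom_mult: "gmonom i a * gmonom j b = gmonom (i + j) (a * b)"
proof (rule gseries_eqI)
  fix n
  have "gcoeff (gmonom i a * gmonom j b) n
      = (\<Sum>(k, l)\<in>decomps {i} {j} n. gcoeff (gmonom i a) k * gcoeff (gmonom j b) l)"
    by (rule gcoeff_mult_superset) (simp_all add: well_ordered_finite gsupp_gmonom)
  also have "decomps {i} {j} n = (if i + j = n then {(i, j)} else {})"
    by (auto simp: decomps_def)
  finally show "gcoeff (gmonom i a * gmonom j b) n = gcoeff (gmonom (i + j) (a * b)) n"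
    by (simp add: lookup_single when_def)
qed

lemma gmonom_1: "gmonom 0 1 = 1"
  by (rule gseries_eqI) (auto simp: gcoeff_1 lookup_single when_def simp del: single_one)

lemma gcoeff_gmonom_0_mult: "gcoeff (gmonom 0 a * f) n = a * gcoeff f n"
proof -
  have "gcoeff (gmonom 0 a * f) n
      = (\<Sum>(k, l)\<in>decomps {0} (gsupp f) n. gcoeff (gmonom 0 a) k * gcoeff f l)"
    by (rule gcoeff_mult_superset) (simp_all add: well_ordered_finite well_ordered_gsupp gsupp_gmonom)
  also have "decomps {0} (gsupp f) n = (if n \<in> gsupp f then {(0, n)} else {})"
    by (auto simp: decomps_def)
  finally show ?thesis by (auto simp: in_gsupp)
qed

lemma gcoeff_of_nat_mult:
  fixes f :: "('g::linordered_ab_group_add, 'k::comm_ring_1) gseries"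
  shows "gcoeff (of_nat c * f) n = of_nat c * gcoeff f n"
  by (induction c) (simp_all add: algebra_simps)

lemma gcoeff_sum: "gcoeff (sum f S) n = (\<Sum>x\<in>S. gcoeff (f x) n)"
  by (induction S rule: infinite_finite_induct) simp_all

lemma scale_0: "scale 0 i = 0"
  by (simp add: scale_def zero_expo_def)

lemma scale_Suc: "scale (Suc m) i = i + scale m i"
  by (simp add: scale_def plus_expo_def frag_cmul_distrib)

lemma monom_gmonom_power:
  "monom (gmonom i a) j ^ m = monom (gmonom (scale m i) (a ^ m)) (m * j)"
proof (induction m)
  case 0
  then show ?case by (simp add: scale_0 gmonom_1 del: single_one)
next
  case (Suc m)
  then show ?case by (simp add: mult_monom gmonom_mult scale_Suc)
qed

text \<open>Each choice of multiplicities yields a single monomial, which carries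
  \<open>vpower\<close>, \<open>vexpo\<close> and \<open>vweight\<close> at once.\<close>

lemma prod_monom_gmonom:
  "(\<Prod>s\<in>S. monom (gmonom (i s) (a s)) (j s) ^ M s) =
    monom (gmonom (\<Sum>s\<in>S. scale (M s) (i s)) (\<Prod>s\<in>S. a s ^ M s)) (\<Sum>s\<in>S. M s * j s)"
proof (induction S rule: infinite_finite_induct)
  case (insert x S)
  then show ?case by (simp add: monom_gmonom_power mult_monom gmonom_mult)
qed (simp_all add: gmonom_1 del: single_one)

text \<open>Supports add under multiplication, and \<open>L\<close> is additive. The bound is
  imposed on the whole support because \<open>L\<close> need not be monotone for the order of the
  exponents.\<close>

lemma filtered_ring_gseries:
  fixes L :: "'g::linordered_ab_group_add \<Rightarrow> int"
  assumes L: "\<And>a b. L (a + b) = L a + L b"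
  shows "filtered_ring (\<lambda>k. {f :: ('g, 'k::comm_ring_1) gseries. \<forall>n\<in>gsupp f. int k \<le> L n})"
proof
  have L0: "L 0 = 0" using L[of 0 0] by simp
  show "1 \<in> {f :: ('g, 'k) gseries. \<forall>n\<in>gsupp f. int 0 \<le> L n}"
    using L0 by (auto simp: in_gsupp gcoeff_1 split: if_splits)
next
  fix f g :: "('g, 'k) gseries" and i j
  assume fg: "f \<in> {f. \<forall>n\<in>gsupp f. int i \<le> L n}" "g \<in> {f. \<forall>n\<in>gsupp f. int j \<le> L n}"
  show "f * g \<in> {f. \<forall>n\<in>gsupp f. int (i + j) \<le> L n}"
  proof safe
    fix n assume "n \<in> gsupp (f * g)"
    then obtain a b where "n = a + b" "a \<in> gsupp f" "b \<in> gsupp g" using gsupp_mult by blast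
    with fg L[of a b] show "int (i + j) \<le> L n" by fastforce
  qed
next
  fix f g :: "('g, 'k) gseries" and k
  assume fg: "f \<in> {f. \<forall>n\<in>gsupp f. int k \<le> L n}" "g \<in> {f. \<forall>n\<in>gsupp f. int k \<le> L n}"
  have "gsupp (f + g) \<subseteq> gsupp f \<union> gsupp g" by (auto simp: in_gsupp)
  with fg show "f + g \<in> {f. \<forall>n\<in>gsupp f. int k \<le> L n}" by blast
qed (fastforce simp: in_gsupp)+

section \<open>Strongly reduced Henselian equations\<close>

lemma well_ordered_least:
  assumes "well_ordered A" "T \<subseteq> A" "x \<in> T"
  obtains m where "m \<in> T" "\<And>t. t \<in> T \<Longrightarrow> m \<le> t"
proof -
  have "T \<noteq> {}" using assms(3) by auto
  then have "\<exists>m\<in>T. \<forall>t\<in>T. m \<le> t"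
    using assms(1)[unfolded well_ordered_def, rule_format, OF assms(2)] by simp
  then show ?thesis using that by auto
qed

text \<open>\<open>val_poly\<close> bounds the least exponent of every coefficient from below, hence
  every exponent.\<close>

lemma strongly_reduced_pos:
  assumes "strongly_reduced r Q" "qcoeff Q (i, j) \<noteq> 0"
  shows "i > 0"
proof -
  let ?f = "coeff (series_poly Q) j"
  have i: "i \<in> gsupp ?f" using assms(2) by (simp add: in_gsupp qcoeff_def)
  then have "?f \<noteq> 0" by (metis gcoeff_0 in_gsupp)
  then have "j \<le> degree (series_poly Q)" by (rule le_degree)
  then have "val_poly (series_poly Q) \<le> val ?f"
    unfolding val_poly_def by (intro Min_le) auto
  moreover have "val_poly (series_poly Q) > 0"
    using assms(1) by (simp add: strongly_reduced_def)
  ultimately have "Fin (LEAST n. n \<in> gsupp ?f) > 0"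
    using \<open>?f \<noteq> 0\<close> by (simp add: val_def)
  then have "(LEAST n. n \<in> gsupp ?f) > 0" by (simp add: zero_extended_def)
  moreover obtain m where m: "m \<in> gsupp ?f" "\<And>n. n \<in> gsupp ?f \<Longrightarrow> m \<le> n"
    by (rule well_ordered_least[OF well_ordered_gsupp subset_refl i]) (rule that)
  then have "(LEAST n. n \<in> gsupp ?f) = m" by (rule Least_equality)
  ultimately show ?thesis using m(2)[OF i] by simp
qed

lemma strongly_reduced_Zr:
  assumes "strongly_reduced r Q" "qcoeff Q (i, j) \<noteq> 0"
  shows "i \<in> Zr r"
proof -
  have "i \<in> Poly_Mapping.keys (coeff Q j)"
    using assms(2) by (simp add: qcoeff_def in_keys_iff)
  then show ?thesis
    using assms(1) by (auto simp: strongly_reduced_def laurent_def)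
qed

text \<open>
  A term of \<open>y\<close> arises from a term of \<open>Q\<close> and smaller terms of \<open>y\<close>, so the least term
  violating the bound cannot exist.
\<close>
lemma solution_support:
  fixes L :: "expo \<Rightarrow> int" and Q :: "(expo \<Rightarrow>\<^sub>0 'k::comm_ring_1) poly"
  assumes L: "\<And>a b. L (a + b) = L a + L b"
    and Q: "\<And>i j. qcoeff Q (i, j) \<noteq> 0 \<Longrightarrow> i > 0" "\<And>i j. qcoeff Q (i, j) \<noteq> 0 \<Longrightarrow> L i \<ge> 1"
    and y: "y = poly (series_poly Q) y" "\<forall>n\<in>gsupp y. n > 0"
    and "n \<in> gsupp y"
  shows "L n \<ge> 1"
proof (rule ccontr)
  assume "\<not> L n \<ge> 1"
  define V where "V = {n \<in> gsupp y. \<not> L n \<ge> 1}"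
  have "V \<subseteq> gsupp y" "n \<in> V"
    using \<open>\<not> L n \<ge> 1\<close> \<open>n \<in> gsupp y\<close> by (auto simp: V_def)
  then obtain m where "m \<in> V" and V: "\<And>t. t \<in> V \<Longrightarrow> m \<le> t"
    by (rule well_ordered_least[OF well_ordered_gsupp]) (rule that)
  then have m: "m \<in> gsupp y" "\<not> L m \<ge> 1" by (simp_all add: V_def)
  have min: "L t \<ge> 1" if "t \<in> gsupp y" "t < m" for t
  proof (rule ccontr)
    assume "\<not> L t \<ge> 1"
    then have "m \<le> t" using that(1) by (intro V) (simp add: V_def)
    then show False using that(2) by simp
  qed
  have L0: "L 0 = 0" using L[of 0 0] by simp
  \<comment> \<open>All exponents of \<open>y\<close> are positive, so the summands of an exponent
    \<open>k < m\<close> of \<open>y ^ j\<close> are themselves below \<open>m\<close>, where the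
    bound holds by minimality.\<close>
  have pow: "k \<ge> 0 \<and> (k < m \<longrightarrow> L k \<ge> 0)" if "k \<in> gsupp (y ^ j)" for k j
    using that
  proof (induction j arbitrary: k)
    case 0
    then show ?case using L0 by (auto simp: in_gsupp gcoeff_1 split: if_splits)
  next
    case (Suc j)
    then obtain a b where k: "k = a + b" "a \<in> gsupp y" "b \<in> gsupp (y ^ j)"
      using gsupp_mult[of y "y ^ j"] by auto
    have a: "a > 0" using y(2) k(2) by blast
    have b: "b \<ge> 0" "b < m \<Longrightarrow> L b \<ge> 0" using Suc.IH k(3) by auto
    have ab: "a \<le> k" "b \<le> k" using a b(1) k(1) by simp_all
    show ?case
    proof (intro conjI impI)
      show "k \<ge> 0" using b(1) ab(2) by (rule order.trans)
      assume "k < m"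
      with ab have "a < m" "b < m" by simp_all
      then show "L k \<ge> 0" using min[OF k(2)] b(2) L[of a b] k(1) by simp
    qed
  qed
  have "y = (\<Sum>j\<le>degree (series_poly Q). series_of (coeff Q j) * y ^ j)"
    by (subst y(1)) (simp add: poly_altdef)
  then have "gcoeff y m = (\<Sum>j\<le>degree (series_poly Q). gcoeff (series_of (coeff Q j) * y ^ j) m)"
    by (metis gcoeff_sum)
  then obtain j where "m \<in> gsupp (series_of (coeff Q j) * y ^ j)"
    using m(1) unfolding in_gsupp by (metis (mono_tags, lifting) sum.neutral)
  then obtain i k where ik: "m = i + k" "i \<in> gsupp (series_of (coeff Q j))" "k \<in> gsupp (y ^ j)"
    using gsupp_mult by blast
  then have "qcoeff Q (i, j) \<noteq> 0" by (simp add: qcoeff_def in_gsupp)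
  then have "i > 0" "L i \<ge> 1" by (rule Q)+
  \<comment> \<open>Here \<open>i > 0\<close> gives \<open>k < m\<close>, as \<open>pow\<close>
    requires.\<close>
  then have "L k \<ge> 0" using pow[OF ik(3)] ik(1) by simp
  then show False using m(2) L[of i k] ik(1) \<open>L i \<ge> 1\<close> by simp
qed

section \<open>Coefficients of the powers of \<open>series_poly Q\<close>\<close>

lemma series_poly_eq_sum:
  "series_poly Q = (\<Sum>s\<in>qsupp Q. monom (gmonom (fst s) (qcoeff Q s)) (snd s))"
proof (rule poly_eqI, rule gseries_eqI)
  fix l n
  have "gcoeff (coeff (\<Sum>s\<in>qsupp Q. monom (gmonom (fst s) (qcoeff Q s)) (snd s)) l) n
      = (\<Sum>s\<in>qsupp Q. if s = (n, l) then qcoeff Q s else 0)"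
    unfolding coeff_sum gcoeff_sum
    by (rule sum.cong) (auto simp: lookup_single when_def prod_eq_iff)
  also have "\<dots> = qcoeff Q (n, l)"
    using finite_qsupp[of Q] by (simp add: qsupp_def)
  finally show "gcoeff (coeff (series_poly Q) l) n
      = gcoeff (coeff (\<Sum>s\<in>qsupp Q. monom (gmonom (fst s) (qcoeff Q s)) (snd s)) l) n"
    by (simp add: qcoeff_def)
qed

text \<open>In the multinomial expansion, degree \<open>m - 1\<close> and exponent \<open>n\<close>
  single out the index vectors. For \<open>m > 0\<close> the truncated \<open>m - 1\<close> agrees
  with the integer condition in \<open>index_vectors\<close>.\<close>

lemma gcoeff_coeff_series_poly_power:
  fixes Q :: "(expo \<Rightarrow>\<^sub>0 'k::field_char_0) poly"
  assumes "m > 0"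
  shows "gcoeff (coeff (series_poly Q ^ m) (m - 1)) n =
    (\<Sum>M\<in>index_vectors Q m n. fact m / of_nat (vfact Q M) * vpower Q M)"
proof -
  let ?S = "qsupp Q"
  let ?t = "\<lambda>M. of_nat (fact m div vfact Q M) *
    (if vweight Q M = m - 1 \<and> vexpo Q M = n then vpower Q M else 0)"
  have "gcoeff (coeff (series_poly Q ^ m) (m - 1)) n = (\<Sum>M\<in>multiplicities ?S m. ?t M)"
    unfolding series_poly_eq_sum multinomial[OF finite_qsupp] coeff_sum gcoeff_sum
      prod_monom_gmonom
    by (rule sum.cong) (auto simp: of_nat_poly gcoeff_of_nat_mult vfact_def vexpo_def
        vweight_def vpower_def case_prod_unfold lookup_single when_def)
  also have "\<dots> = (\<Sum>M\<in>index_vectors Q m n. ?t M)"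
  proof (rule sum.mono_neutral_right)
    show "finite (multiplicities ?S m)" by (rule finite_multiplicities[OF finite_qsupp])
    show "index_vectors Q m n \<subseteq> multiplicities ?S m"
      by (auto simp: index_vectors_def multiplicities_def vsize_def)
    show "\<forall>M\<in>multiplicities ?S m - index_vectors Q m n. ?t M = 0"
      using assms by (auto simp: index_vectors_def multiplicities_def vsize_def of_nat_diff)
  qed
  also have "\<dots> = (\<Sum>M\<in>index_vectors Q m n. fact m / of_nat (vfact Q M) * vpower Q M)"
  proof (rule sum.cong)
    fix M assume M: "M \<in> index_vectors Q m n"
    then have "int (vweight Q M) = int m - 1" "vexpo Q M = n" "sum M ?S = m"
      by (simp_all add: index_vectors_def vsize_def)
    moreover from this have "vweight Q M = m - 1" by linarith
    \<comment> \<open>Being exact, the integer quotient becomes a quotient in the field, where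
      characteristic zero keeps \<open>vfact\<close> nonzero.\<close>
    moreover obtain d where "fact (sum M ?S) = vfact Q M * d"
      unfolding vfact_def using prod_fact_dvd_fact_sum[of M ?S] by blast
    moreover from this have "(fact (sum M ?S) :: 'k) = of_nat (vfact Q M) * of_nat d"
      by (metis of_nat_fact of_nat_mult)
    moreover have "vfact Q M > 0" by (simp add: vfact_def prod_pos)
    ultimately show "?t M = fact m / of_nat (vfact Q M) * vpower Q M"
      by simp
  qed simp
  finally show ?thesis .
qed

section \<open>The linear form of the bound\<close>

lemma iota0_nonneg: "iota0 Q k \<ge> 0"
  and iota0_bound: "qcoeff Q (i, j) \<noteq> 0 \<Longrightarrow> - iota0 Q k \<le> coord i k"
proof -
  have "{coord i k |i j. qcoeff Q (i, j) \<noteq> 0} = (\<lambda>s. coord (fst s) k) ` qsupp Q"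
    by (force simp: qsupp_def)
  then have fin: "finite ({0} \<union> {coord i k |i j. qcoeff Q (i, j) \<noteq> 0})"
    using finite_qsupp[of Q] by simp
  show "iota0 Q k \<ge> 0"
    unfolding iota0_def using Min_le[OF fin, of 0] by simp
  show "- iota0 Q k \<le> coord i k" if "qcoeff Q (i, j) \<noteq> 0"
    unfolding iota0_def using Min_le[OF fin, of "coord i k"] that by auto
qed

lemma lookup_zero_coords: "Poly_Mapping.lookup (coords 0) k = 0"
  by (simp add: zero_expo_def)

text \<open>
  With \<open>T k = \<Prod>j=k+1..t. (1 + \<iota> j)\<close> one has \<open>\<iota> k * T k = T (k - 1) - T k\<close>, so the
  worst case of each tail of the sum telescopes.
\<close>
lemma tail_sum_ge:
  fixes \<iota> c :: "nat \<Rightarrow> int"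
  assumes "\<And>k. \<iota> k \<ge> 0" "\<And>k. c k \<ge> - \<iota> k" "s \<le> t"
  shows "(\<Sum>k=s+1..t. (\<Prod>j=k+1..t. 1 + \<iota> j) * c k) \<ge> 1 - (\<Prod>j=s+1..t. 1 + \<iota> j)"
  using assms(3)
proof (induction s rule: inc_induct)
  case (step s)
  let ?T = "\<lambda>s. \<Prod>j=s+1..t. 1 + \<iota> j"
  have "?T (Suc s) \<ge> 0" using assms(1) by (intro prod_nonneg) (simp add: add_nonneg_nonneg)
  then have "?T (Suc s) * c (Suc s) \<ge> ?T (Suc s) * (- \<iota> (Suc s))"
    using assms(2) by (intro mult_left_mono)
  moreover have "{s + 1..t} = insert (Suc s) {Suc s + 1..t}" using step.hyps by auto
  ultimately show ?case using step.IH by (simp add: algebra_simps)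
qed simp

text \<open>The form equals \<open>T 0\<close> times the total degree plus the sum of the
  \<open>T k * coord i k\<close> for \<open>k \<le> t\<close>. If the total is positive,
  \<open>T 0\<close> outweighs the worst tail \<open>1 - T 0\<close>; if it is zero, the leading
  positive coordinate \<open>s\<close> contributes at least \<open>T s\<close>, against a tail of at
  least \<open>1 - T s\<close>.\<close>

lemma linear_form_ge_1:
  assumes "r \<ge> 2" and i: "i \<in> Zr r" "i > 0" and bound: "\<And>k. coord i k \<ge> - iota0 Q k"
  shows "(\<Sum>k=1..r. lam r Q k * coord i k) \<ge> 1"
proof -
  define t where "t = r - 1"
  have r: "r = Suc t" "t \<ge> 1" using \<open>r \<ge> 2\<close> by (simp_all add: t_def)
  define T where "T k = (\<Prod>j=k+1..t. 1 + iota0 Q j)" for k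
  \<comment> \<open>The case \<open>k = r - 1\<close> of \<open>lam\<close> fits since
    \<open>T t\<close> is an empty product.\<close>
  have lam: "lam r Q k = (if k \<le> t then T k else 0) + T 0" if "k \<le> r" for k
    using that r by (auto simp: lam_def T_def)
  have total: "total i = (\<Sum>k=1..r. coord i k)"
    using i(1) by (intro total_eq_sum) (auto simp: Zr_def)
  have "(\<Sum>k=1..r. lam r Q k * coord i k)
      = (\<Sum>k=1..r. (if k \<le> t then T k * coord i k else 0)) + T 0 * total i"
    unfolding total sum_distrib_left sum.distrib[symmetric]
    by (rule sum.cong) (auto simp: lam algebra_simps)
  also have "(\<Sum>k=1..r. (if k \<le> t then T k * coord i k else 0)) = (\<Sum>k=1..t. T k * coord i k)"
    by (simp add: r)
  finally have eq: "(\<Sum>k=1..r. lam r Q k * coord i k) = (\<Sum>k=1..t. T k * coord i k) + T 0 * total i" .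
  have tail: "(\<Sum>k=s+1..t. T k * coord i k) \<ge> 1 - T s" if "s \<le> t" for s
    unfolding T_def by (rule tail_sum_ge[OF iota0_nonneg bound that])
  have T_pos: "T k \<ge> 1" for k
    unfolding T_def using iota0_nonneg by (intro prod_ge_1) simp
  consider "total i \<ge> 1" | "total i = 0" "coords 0 < coords i"
    using i(2) by (auto simp: less_expo_def total_def zero_expo_def coord_def)
  then show ?thesis
  proof cases
    case 1
    then have "T 0 * total i \<ge> T 0 * 1" using T_pos[of 0] by (intro mult_left_mono) auto
    then show ?thesis using eq tail[of 0] by simp
  next
    case 2
    then obtain s where s: "coord i s > 0" "\<And>k. k < s \<Longrightarrow> coord i k = 0"
      by (auto simp: less_poly_mapping.rep_eq less_fun_def coord_def lookup_zero_coords)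
    have "s \<in> {1..r}"
      using s(1) i(1) by (auto simp: Zr_def coord_def in_keys_iff subset_iff)
    \<comment> \<open>If only the last coordinate were nonzero, the total would equal it and be
      positive.\<close>
    moreover have "s \<noteq> r"
    proof
      assume "s = r"
      then have "total i = coord i r"
        unfolding total using s(2) r by (simp add: sum.neutral)
      then show False using 2(1) s(1) \<open>s = r\<close> by simp
    qed
    ultimately have st: "1 \<le> s" "s \<le> t" using r by auto
    have "(\<Sum>k=1..t. T k * coord i k) = (\<Sum>k=s..t. T k * coord i k)"
      using st s(2) by (intro sum.mono_neutral_right) auto
    also have "\<dots> = T s * coord i s + (\<Sum>k=s+1..t. T k * coord i k)"
      using st by (simp add: sum.atLeast_Suc_atMost)
    also have "\<dots> \<ge> T s * 1 + (1 - T s)"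
      using tail[OF st(2)] T_pos[of s] s(1) by (intro add_mono mult_left_mono) auto
    finally show ?thesis using eq 2(1) by simp
  qed
qed

text \<open>\<open>n\<close> is a sum of \<open>m\<close> exponents of \<open>Q\<close>, with
  repetition, and \<open>L\<close> is at least 1 on each.\<close>

lemma index_vectors_le:
  fixes L :: "expo \<Rightarrow> int"
  assumes L: "\<And>a b. L (a + b) = L a + L b"
    and Q: "\<And>i j. qcoeff Q (i, j) \<noteq> 0 \<Longrightarrow> L i \<ge> 1"
    and M: "M \<in> index_vectors Q m n"
  shows "int m \<le> L n"
proof -
  have L0: "L 0 = 0" using L[of 0 0] by simp
  have L_scale: "L (scale c i) = int c * L i" for c i
    by (induction c) (simp_all add: scale_0 scale_Suc L L0 algebra_simps)
  have L_sum: "L (sum f S) = (\<Sum>x\<in>S. L (f x))" for f and S :: "(expo \<times> nat) set"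
    by (induction S rule: infinite_finite_induct) (simp_all add: L L0)
  have "int m = (\<Sum>s\<in>qsupp Q. int (M s))"
    using M by (simp add: index_vectors_def vsize_def flip: of_nat_sum)
  also have "\<dots> \<le> (\<Sum>s\<in>qsupp Q. int (M s) * L (fst s))"
  proof (rule sum_mono)
    fix s assume "s \<in> qsupp Q"
    then have "L (fst s) \<ge> 1" using Q[of "fst s" "snd s"] by (simp add: qsupp_def)
    then show "int (M s) \<le> int (M s) * L (fst s)" by (simp add: mult_le_cancel_left1)
  qed
  also have "\<dots> = L (vexpo Q M)"
    by (simp add: vexpo_def L_sum L_scale case_prod_unfold)
  also have "vexpo Q M = n" using M by (simp add: index_vectors_def)
  finally show ?thesis .
qed

section \<open>The coefficient formula\<close>

theorem theorem4p5:
  fixes r :: nat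
    and Q :: "(expo \<Rightarrow>\<^sub>0 'k::field_char_0) poly"
    and y0 :: "(expo, 'k) gseries"
  assumes "r \<ge> 2"
    and "strongly_reduced r Q"
    and "is_solution r Q y0"
  shows "(\<forall>n\<in>Zr r. n > 0 \<longrightarrow>
      gcoeff y0 n =
        (\<Sum>m=1..mu Q n. 1 / of_nat m *
          (\<Sum>M\<in>index_vectors Q m n. fact m / of_nat (vfact Q M) * vpower Q M)))
    \<and> (\<forall>n\<in>Zr r. (\<exists>m. index_vectors Q m n \<noteq> {}) \<longrightarrow>
      (\<forall>m. index_vectors Q m n \<noteq> {} \<longrightarrow> m \<le> mu Q n) \<and>
      int (mu Q n) \<le> (\<Sum>k=1..r. lam r Q k * coord n k))"
proof -
  define L where "L n = (\<Sum>k=1..r. lam r Q k * coord n k)" for n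
  have L_add: "L (a + b) = L a + L b" for a b
    by (simp add: L_def algebra_simps sum.distrib)
  have Q_pos: "i > 0" if "qcoeff Q (i, j) \<noteq> 0" for i j
    using strongly_reduced_pos[OF assms(2) that] .
  have Q_L: "L i \<ge> 1" if "qcoeff Q (i, j) \<noteq> 0" for i j
    unfolding L_def
    by (rule linear_form_ge_1[OF assms(1) strongly_reduced_Zr[OF assms(2) that] Q_pos[OF that]])
      (rule iota0_bound[OF that])
  have le_L: "int m \<le> L n" if "index_vectors Q m n \<noteq> {}" for m n
    using that index_vectors_le[of L Q _ m n] L_add Q_L by blast
  \<comment> \<open>The bound makes the \<open>GREATEST\<close> in \<open>mu\<close>
    meaningful.\<close>
  have bounded: "m \<le> nat (L n)" if "index_vectors Q m n \<noteq> {}" for m n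
    using le_L[OF that] by simp
  have le_mu: "m \<le> mu Q n" if "index_vectors Q m n \<noteq> {}" for m n
    using Greatest_le_nat[of "\<lambda>m. index_vectors Q m n \<noteq> {}" m "nat (L n)"] that bounded
    by (auto simp: mu_def)
  have mu_le: "int (mu Q n) \<le> L n" if "index_vectors Q m n \<noteq> {}" for m n
  proof -
    have "index_vectors Q (mu Q n) n \<noteq> {}"
      using GreatestI_nat[of "\<lambda>m. index_vectors Q m n \<noteq> {}" m "nat (L n)"] that bounded
      by (auto simp: mu_def)
    then show ?thesis by (rule le_L)
  qed
  interpret filtered_ring "\<lambda>k. {f :: (expo, 'k) gseries. \<forall>n\<in>gsupp f. int k \<le> L n}"
    by (rule filtered_ring_gseries) (rule L_add)
  define inv :: "nat \<Rightarrow> (expo, 'k) gseries" where "inv m = gmonom 0 (1 / of_nat m)" for m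
  have inv: "of_nat m * inv m = 1" if "m > 0" for m
    using that by (intro gseries_eqI)
      (simp add: inv_def gcoeff_of_nat_mult gcoeff_1 lookup_single when_def)
  have inv_mem: "inv m \<in> {f. \<forall>n\<in>gsupp f. int 0 \<le> L n}" for m
    using gsupp_gmonom[of 0 "1 / of_nat m :: 'k"] L_add[of 0 0] by (auto simp: inv_def)
  have q_mem: "coeff (series_poly Q) j \<in> {f. \<forall>n\<in>gsupp f. int 1 \<le> L n}" for j
    using Q_L[of _ j] by (auto simp: in_gsupp qcoeff_def)
  have y: "y0 = poly (series_poly Q) y0" "\<forall>n\<in>gsupp y0. n > 0"
    using assms(3) by (auto simp: is_solution_def)
  have y_mem: "y0 \<in> {f. \<forall>n\<in>gsupp f. int 1 \<le> L n}"
    using solution_support[of L Q y0, OF L_add Q_pos Q_L y] by auto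
  have "gcoeff y0 n = (\<Sum>m=1..mu Q n. 1 / of_nat m *
      (\<Sum>M\<in>index_vectors Q m n. fact m / of_nat (vfact Q M) * vpower Q M))" for n
  proof -
    \<comment> \<open>\<open>N\<close> is at least 1 for \<open>lagrange_inversion\<close>, at least
      \<open>L n\<close> so that the error term has no coefficient at \<open>n\<close>, and at least
      \<open>mu Q n\<close> so that the sum can be cut back.\<close>
    define N where "N = max 1 (max (mu Q n) (nat (L n)))"
    let ?f = "(\<Sum>m=1..N. inv m * coeff (series_poly Q ^ m) (m - 1)) - y0"
    have "?f \<in> {f. \<forall>n\<in>gsupp f. int (Suc N) \<le> L n}"
      by (rule lagrange_inversion[OF inv inv_mem q_mem y_mem y(1)[symmetric]])
        (simp_all add: N_def)
    moreover have "\<not> int (Suc N) \<le> L n" by (simp add: N_def)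
    ultimately have "gcoeff ?f n = 0" by (auto simp: in_gsupp)
    then have "gcoeff y0 n = (\<Sum>m=1..N. 1 / of_nat m * gcoeff (coeff (series_poly Q ^ m) (m - 1)) n)"
      by (simp add: gcoeff_sum inv_def gcoeff_gmonom_0_mult)
    also have "\<dots> = (\<Sum>m=1..N. 1 / of_nat m *
        (\<Sum>M\<in>index_vectors Q m n. fact m / of_nat (vfact Q M) * vpower Q M))"
      by (rule sum.cong) (simp_all add: gcoeff_coeff_series_poly_power[unfolded One_nat_def])
    also have "\<dots> = (\<Sum>m=1..mu Q n. 1 / of_nat m *
        (\<Sum>M\<in>index_vectors Q m n. fact m / of_nat (vfact Q M) * vpower Q M))"
    \<comment> \<open>No index vector has size beyond \<open>mu Q n\<close>; if there is none at
      all, \<open>mu Q n\<close> is 0 and the remaining sum is empty.\<close>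
    proof (rule sum.mono_neutral_right)
      show "{1..mu Q n} \<subseteq> {1..N}" by (auto simp: N_def)
      have "index_vectors Q m n = {}" if "m \<notin> {1..mu Q n}" "m \<ge> 1" for m
        using that le_mu[of m n] by fastforce
      then show "\<forall>m\<in>{1..N} - {1..mu Q n}. 1 / of_nat m *
          (\<Sum>M\<in>index_vectors Q m n. fact m / of_nat (vfact Q M) * vpower Q M) = 0"
        by auto
    qed simp
    finally show ?thesis .
  qed
  then show ?thesis using le_mu mu_le unfolding L_def by blast
qed

end
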